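(* Let $h:\mathbb{R}^m\to\bar{\mathbb{R}}$ be lower semicontinuous, let $c:\mathbb{R}^n\to\mathbb{R}^m$ be continuously differentiable, and let $\bar x\in\mathbb{R}^n$ be a critical point of $h\circ c$ satisfying $\partial^\infty h(c(\bar x))\cap N(\nabla c(\bar x)^* )=\{0\}$. Let $\mathcal{G}$ be any finite family of closed subsets of $\mathrm{gph}(\partial h)$. Then there exists $\bar\epsilon>0$ such that for every $\epsilon\in(0,\bar\epsilon)$ there exists $\delta>0$ with the following property. For any $x\in\mathbb{R}^n$ with $|x-\bar x|<\delta$, if there exist a set $G\in\mathcal{G}$ and a pair $(\hat c,v)\in\mathbb{R}^m\times\mathbb{R}^m$ with $$\mathrm{dist}\big((\hat c,v),G\big)<\epsilon$$ and $$v\in\partial h(\hat c),\quad |\hat c-c(x)|<\delta,\quad \big|h(\hat c)-h(c(\bar x))\big|<\delta,\quad |\nabla c(x)^*v|<\delta,$$ then $G$ is an actively sufficient set for $\bar x$.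
   Context: $\bar{\mathbb{R}}=[-\infty,+\infty]$; $|\cdot|$ is the Euclidean norm and $\mathrm{dist}$ the Euclidean distance to a set ($+\infty$ for the empty set). Subdifferentials are as in Rockafellar–Wets, Variational Analysis: at a point $\bar c$ where $h$ is finite, $v$ is a regular subgradient if $h(c)\ge h(\bar c)+\langle v,c-\bar c\rangle+o(|c-\bar c|)$; $v\in\partial h(\bar c)$ if there are $c_r\to\bar c$ with $h(c_r)\to h(\bar c)$ and regular subgradients $v_r$ of $h$ at $c_r$ with $v_r\to v$; $v\in\partial^\infty h(\bar c)$ (horizon subdifferential) if there are such $c_r$, regular subgradients $v_r$ at $c_r$, and scalars $\lambda_r\downarrow0$ with $\lambda_r v_r\to v$. Where $h$ is not finite, $\partial h=\emptyset$. $\mathrm{gph}(\partial h)=\{(c,v):v\in\partial h(c)\}$. $\nabla c(x)^*$ is the adjoint of the derivative $\nabla c(x):\mathbb{R}^n\to\mathbb{R}^m$, and $N(\cdot)$ denotes null space. A point $\bar x$ is critical for $h\circ c$ if $0\in\partial(h\circ c)(\bar x)$. A multiplier vector for a critical point $\bar x$ is $v\in\mathbb{R}^m$ with $v\in\partial h(c(\bar x))$ and $\nabla c(\bar x)^*v=0$. An actively sufficient set for $\bar x$ is a set $G\subset\mathrm{gph}(\partial h)$ containing a point $(c(\bar x),\bar v)$ where $\bar v$ is a multiplier vector for $\bar x$. *)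

theory Defs
  imports "HOL-Analysis.Analysis" "HOL-Library.Landau_Symbols"
begin

definition lower_semicontinuous :: "('a::topological_space \<Rightarrow> ereal) \<Rightarrow> bool" where
  "lower_semicontinuous h \<longleftrightarrow> (\<forall>x. h x \<le> Liminf (at x) h)"

(* The o-term is only constrained near the base point, so the inequality is local: h may take
   the value -\<infinity> elsewhere. *)
definition regular_subdiff ::
    "('a::euclidean_space \<Rightarrow> ereal) \<Rightarrow> 'a \<Rightarrow> 'a set" where
  "regular_subdiff h x =
     {v. \<bar>h x\<bar> \<noteq> \<infinity> \<and>
         (\<exists>r :: 'a \<Rightarrow> real. r \<in> o[at x](\<lambda>y. norm (y - x)) \<and>
            (\<forall>\<^sub>F y in at x. h y \<ge> h x + ereal (v \<bullet> (y - x) + r y)))}"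

definition subdiff :: "('a::euclidean_space \<Rightarrow> ereal) \<Rightarrow> 'a \<Rightarrow> 'a set" where
  "subdiff h x =
     {v. \<bar>h x\<bar> \<noteq> \<infinity> \<and>
         (\<exists>xs vs. xs \<longlonglongrightarrow> x \<and> (\<lambda>r. h (xs r)) \<longlonglongrightarrow> h x \<and>
            (\<forall>r::nat. vs r \<in> regular_subdiff h (xs r)) \<and> vs \<longlonglongrightarrow> v)}"

definition horizon_subdiff :: "('a::euclidean_space \<Rightarrow> ereal) \<Rightarrow> 'a \<Rightarrow> 'a set" where
  "horizon_subdiff h x =
     {v. \<bar>h x\<bar> \<noteq> \<infinity> \<and>
         (\<exists>xs vs (ls :: nat \<Rightarrow> real). xs \<longlonglongrightarrow> x \<and> (\<lambda>r. h (xs r)) \<longlonglongrightarrow> h x \<and>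
            (\<forall>r. vs r \<in> regular_subdiff h (xs r)) \<and>
            (\<forall>r. ls r > 0) \<and> ls \<longlonglongrightarrow> 0 \<and> (\<lambda>r. ls r *\<^sub>R vs r) \<longlonglongrightarrow> v)}"

definition gph_subdiff :: "('a::euclidean_space \<Rightarrow> ereal) \<Rightarrow> ('a \<times> 'a) set" where
  "gph_subdiff h = {(y, v). v \<in> subdiff h y}"

(* Unlike infdist, which is 0 for the empty set. *)
definition dist_to_set :: "'a::metric_space \<Rightarrow> 'a set \<Rightarrow> ereal" where
  "dist_to_set x A = (if A = {} then \<infinity> else ereal (infdist x A))"

definition continuously_differentiable ::
    "('a::real_normed_vector \<Rightarrow> 'b::real_normed_vector) \<Rightarrow> bool" where
  "continuously_differentiable c \<longleftrightarrow>
     (\<exists>c' :: 'a \<Rightarrow> 'a \<Rightarrow>\<^sub>L 'b.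
        (\<forall>x. (c has_derivative blinfun_apply (c' x)) (at x)) \<and> continuous_on UNIV c')"

definition adj_deriv ::
    "('a::euclidean_space \<Rightarrow> 'b::euclidean_space) \<Rightarrow> 'a \<Rightarrow> 'b \<Rightarrow> 'a" where
  "adj_deriv c x = adjoint (frechet_derivative c (at x))"

definition critical_point :: "('a::euclidean_space \<Rightarrow> ereal) \<Rightarrow> 'a \<Rightarrow> bool" where
  "critical_point f x \<longleftrightarrow> 0 \<in> subdiff f x"

definition multiplier_vector ::
    "('b::euclidean_space \<Rightarrow> ereal) \<Rightarrow> ('a::euclidean_space \<Rightarrow> 'b) \<Rightarrow> 'a \<Rightarrow> 'b \<Rightarrow> bool" where
  "multiplier_vector h c x v \<longleftrightarrow> v \<in> subdiff h (c x) \<and> adj_deriv c x v = 0"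

definition actively_sufficient ::
    "('b::euclidean_space \<Rightarrow> ereal) \<Rightarrow> ('a::euclidean_space \<Rightarrow> 'b) \<Rightarrow> 'a \<Rightarrow> ('b \<times> 'b) set \<Rightarrow> bool"
  where
  "actively_sufficient h c x G \<longleftrightarrow>
     G \<subseteq> gph_subdiff h \<and> (\<exists>v. multiplier_vector h c x v \<and> (c x, v) \<in> G)"

end

theory Submission
  imports Defs
begin

text \<open>
  Let \<open>M\<close> be the set of multiplier vectors. Along \<open>x\<^sub>r \<rightarrow> xbar\<close>, \<open>c\<^sub>r \<rightarrow> c xbar\<close> with \<open>h c\<^sub>r \<rightarrow> h (c xbar)\<close>,
  subgradients \<open>v\<^sub>r\<close> at \<open>c\<^sub>r\<close> whose images under the adjoint derivatives tend to \<open>0\<close>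
  subconverge to an element of \<open>M\<close>: if they blew up, normalising them would give a unit horizon subgradient in the
  null space, against the constraint qualification. Hence \<open>M\<close> is compact, and the (closed) union of
  the sets of the family that are not actively sufficient has positive distance from \<open>{c xbar} \<times> M\<close>.
  This distance serves as \<open>\<epsilon>bar\<close>: a failure of the claim for some smaller \<open>\<epsilon>\<close> would produce a sequence
  as above whose limit in \<open>{c xbar} \<times> M\<close> is within \<open>\<epsilon>\<close> of that union.
\<close>

section \<open>Regular approximation and closedness of subdifferentials\<close>

text \<open>Both function values are finite, since the subdifferentials are empty elsewhere, so
  \<open>real_of_ereal\<close> measures their gap faithfully.\<close>

lemma subdiff_approx_regular:
  assumes v: "v \<in> subdiff h y" and "e > 0"
  shows "\<exists>y' v'. v' \<in> regular_subdiff h y' \<and> dist y' y < e \<and> dist v' v < e \<and>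
           dist (real_of_ereal (h y')) (real_of_ereal (h y)) < e"
proof -
  from v obtain xs vs where fin: "\<bar>h y\<bar> \<noteq> \<infinity>" and lim: "xs \<longlonglongrightarrow> y" "(\<lambda>r. h (xs r)) \<longlonglongrightarrow> h y" "vs \<longlonglongrightarrow> v"
    and reg: "\<And>r::nat. vs r \<in> regular_subdiff h (xs r)"
    unfolding subdiff_def mem_Collect_eq by metis
  have "(\<lambda>r. real_of_ereal (h (xs r))) \<longlonglongrightarrow> real_of_ereal (h y)"
    using lim(2) fin by (intro lim_real_of_ereal) (auto simp: ereal_real')
  with lim have "\<forall>\<^sub>F r in sequentially. dist (xs r) y < e \<and> dist (vs r) v < e \<and>
      dist (real_of_ereal (h (xs r))) (real_of_ereal (h y)) < e"
    using \<open>e > 0\<close> by (intro eventually_conj tendstoD)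
  then obtain r where "dist (xs r) y < e" "dist (vs r) v < e"
      "dist (real_of_ereal (h (xs r))) (real_of_ereal (h y)) < e"
    by (auto simp: eventually_sequentially)
  with reg show ?thesis by blast
qed

lemma tendsto_of_dist_inverse_Suc:
  fixes a b :: "nat \<Rightarrow> 'a::real_normed_vector"
  assumes "\<And>r. dist (a r) (b r) < inverse (real (Suc r))"
  shows "(\<lambda>r. a r - b r) \<longlonglongrightarrow> 0"
  by (rule Lim_null_comparison[OF _ LIMSEQ_inverse_real_of_nat])
    (use assms in \<open>auto simp: dist_norm intro!: always_eventually less_imp_le\<close>)

text \<open>Diagonal choice: the r-th subgradient is replaced by a regular one with errors below
  \<open>1/(r+1)\<close>. Only the difference \<open>ws r - vs r\<close> is controlled, so
  \<open>vs\<close> may be unbounded, as the horizon case requires.\<close>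

lemma subdiff_sequence_approx_regular:
  fixes h :: "'a::euclidean_space \<Rightarrow> ereal"
  assumes fin: "\<bar>h x\<bar> \<noteq> \<infinity>" and "xs \<longlonglongrightarrow> x" and "(\<lambda>r. h (xs r)) \<longlonglongrightarrow> h x"
    and "\<And>r. vs r \<in> subdiff h (xs r)"
  obtains ys ws where "ys \<longlonglongrightarrow> x" "(\<lambda>r. h (ys r)) \<longlonglongrightarrow> h x" "\<And>r. ws r \<in> regular_subdiff h (ys r)"
    "(\<lambda>r. ws r - vs r) \<longlonglongrightarrow> 0"
proof -
  have "\<forall>r. \<exists>y v. v \<in> regular_subdiff h y \<and> dist y (xs r) < inverse (real (Suc r)) \<and>
          dist v (vs r) < inverse (real (Suc r)) \<and>
          dist (real_of_ereal (h y)) (real_of_ereal (h (xs r))) < inverse (real (Suc r))"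
    by (intro allI subdiff_approx_regular assms(4)) simp
  then obtain ys ws where reg: "\<And>r. ws r \<in> regular_subdiff h (ys r)"
    and near: "\<And>r. dist (ys r) (xs r) < inverse (real (Suc r))"
      "\<And>r. dist (ws r) (vs r) < inverse (real (Suc r))"
      "\<And>r. dist (real_of_ereal (h (ys r))) (real_of_ereal (h (xs r))) < inverse (real (Suc r))"
    by metis
  note null = near[THEN tendsto_of_dist_inverse_Suc]
  have y: "ys \<longlonglongrightarrow> x"
    using tendsto_add[OF null(1) assms(2)] by simp
  have "(\<lambda>r. real_of_ereal (h (xs r))) \<longlonglongrightarrow> real_of_ereal (h x)"
    using assms(3) fin by (intro lim_real_of_ereal) (auto simp: ereal_real')
  from tendsto_add[OF null(3) this]
  have "(\<lambda>r. ereal (real_of_ereal (h (ys r)))) \<longlonglongrightarrow> ereal (real_of_ereal (h x))"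
    by (intro tendsto_ereal) simp
  \<comment> \<open>A regular subgradient exists at \<open>ys r\<close>, so the value there is
    finite and the real limit transfers back.\<close>
  moreover have "ereal (real_of_ereal (h (ys r))) = h (ys r)" for r
    using reg[of r] by (simp add: regular_subdiff_def ereal_real')
  ultimately have "(\<lambda>r. h (ys r)) \<longlonglongrightarrow> h x"
    using fin by (simp add: ereal_real')
  with y reg null(2) show ?thesis by (intro that)
qed

lemma subdiff_limit:
  assumes fin: "\<bar>h x\<bar> \<noteq> \<infinity>" and "xs \<longlonglongrightarrow> x" and "(\<lambda>r. h (xs r)) \<longlonglongrightarrow> h x"
    and "\<And>r. vs r \<in> subdiff h (xs r)" and "vs \<longlonglongrightarrow> v"
  shows "v \<in> subdiff h x"
proof -
  obtain ys ws where y: "ys \<longlonglongrightarrow> x" "(\<lambda>r. h (ys r)) \<longlonglongrightarrow> h x" "\<And>r. ws r \<in> regular_subdiff h (ys r)"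
    and d: "(\<lambda>r. ws r - vs r) \<longlonglongrightarrow> 0"
    using subdiff_sequence_approx_regular[OF assms(1-4)] by blast
  have "ws \<longlonglongrightarrow> v" using tendsto_add[OF d assms(5)] by simp
  with y fin show ?thesis unfolding subdiff_def by blast
qed

text \<open>Passing to regular subgradients costs \<open>ls r *\<^sub>R (ws r - vs r)\<close>, which
  vanishes because both factors do.\<close>

lemma horizon_subdiff_limit:
  fixes ls :: "nat \<Rightarrow> real"
  assumes fin: "\<bar>h x\<bar> \<noteq> \<infinity>" and "xs \<longlonglongrightarrow> x" and "(\<lambda>r. h (xs r)) \<longlonglongrightarrow> h x"
    and "\<And>r. vs r \<in> subdiff h (xs r)"
    and ls: "\<And>r. ls r > 0" "ls \<longlonglongrightarrow> 0" and "(\<lambda>r. ls r *\<^sub>R vs r) \<longlonglongrightarrow> v"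
  shows "v \<in> horizon_subdiff h x"
proof -
  obtain ys ws where y: "ys \<longlonglongrightarrow> x" "(\<lambda>r. h (ys r)) \<longlonglongrightarrow> h x" "\<And>r. ws r \<in> regular_subdiff h (ys r)"
    and d: "(\<lambda>r. ws r - vs r) \<longlonglongrightarrow> 0"
    using subdiff_sequence_approx_regular[OF assms(1-4)] by blast
  have "(\<lambda>r. ls r *\<^sub>R ws r) \<longlonglongrightarrow> v"
    using tendsto_add[OF tendsto_scaleR[OF ls(2) d] assms(7)] by (simp add: scaleR_diff_right)
  with y fin ls show ?thesis unfolding horizon_subdiff_def by blast
qed

section \<open>Continuity of the adjoint derivative\<close>

lemma inner_adj_deriv:
  assumes "(c has_derivative c') (at x)"
  shows "adj_deriv c x v \<bullet> w = v \<bullet> c' w"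
  using adjoint_works[OF has_derivative_linear[OF assms], of w v]
    frechet_derivative_at[OF assms] by (simp add: adj_deriv_def inner_commute)

lemma adj_deriv_scaleR:
  fixes a :: real
  assumes "c differentiable at x"
  shows "adj_deriv c x (a *\<^sub>R v) = a *\<^sub>R adj_deriv c x v"
  by (rule vector_eq_rdot[THEN iffD1])
    (simp add: inner_adj_deriv[OF assms[unfolded frechet_derivative_works]])

lemma tendsto_adj_deriv:
  fixes c :: "'a::euclidean_space \<Rightarrow> 'b::euclidean_space"
  assumes "continuously_differentiable c" and x: "xs \<longlonglongrightarrow> x" and v: "vs \<longlonglongrightarrow> v"
  shows "(\<lambda>r. adj_deriv c (xs r) (vs r)) \<longlonglongrightarrow> adj_deriv c x v"
proof -
  obtain c' :: "'a \<Rightarrow> 'a \<Rightarrow>\<^sub>L 'b" where c': "\<And>x. (c has_derivative blinfun_apply (c' x)) (at x)"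
    and cont: "continuous_on UNIV c'"
    using assms(1) unfolding continuously_differentiable_def by blast
  have "(\<lambda>r. c' (xs r)) \<longlonglongrightarrow> c' x"
    using continuous_on_tendsto_compose[OF cont x] by simp
  then show ?thesis
    \<comment> \<open>Each coordinate is \<open>v \<bullet> c' x b\<close> for a basis vector
      \<open>b\<close>, which is jointly continuous in \<open>v\<close> and the operator
      \<open>c' x\<close>.\<close>
    unfolding tendsto_componentwise_iff[of "\<lambda>r. adj_deriv c (xs r) (vs r)"] inner_adj_deriv[OF c']
    by (intro ballI tendsto_intros v)
qed

section \<open>Convergence and compactness of multipliers\<close>

text \<open>
  Normalising by \<open>1 + norm v\<^sub>r\<close> covers bounded and unbounded sequences at once: the pairs
  \<open>(v\<^sub>r, 1) / (1 + norm v\<^sub>r)\<close> stay in a compact set, and the second component of a limit vanishes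
  exactly when the subsequence blows up.
\<close>
lemma multiplier_vector_subsequence:
  fixes h :: "'b::euclidean_space \<Rightarrow> ereal" and c :: "'a::euclidean_space \<Rightarrow> 'b"
  assumes c: "continuously_differentiable c"
    and cq: "horizon_subdiff h (c x) \<inter> {v. adj_deriv c x v = 0} = {0}"
    and x: "xs \<longlonglongrightarrow> x" and y: "ys \<longlonglongrightarrow> c x" and h: "(\<lambda>r. h (ys r)) \<longlonglongrightarrow> h (c x)"
    and v: "\<And>r. vs r \<in> subdiff h (ys r)"
    and adj: "(\<lambda>r. adj_deriv c (xs r) (vs r)) \<longlonglongrightarrow> 0"
  obtains k v where "strict_mono (k :: nat \<Rightarrow> nat)" "(vs \<circ> k) \<longlonglongrightarrow> v" "multiplier_vector h c x v"
proof -
  \<comment> \<open>The constraint qualification is an equality with \<open>{0}\<close>; membership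
    of 0 carries the finiteness of \<open>h (c x)\<close>.\<close>
  have "0 \<in> horizon_subdiff h (c x)"
    using cq by blast
  then have fin: "\<bar>h (c x)\<bar> \<noteq> \<infinity>"
    unfolding horizon_subdiff_def by simp
  define s where "s r = inverse (1 + norm (vs r))" for r
  have pos: "1 + norm (vs r) > 0" for r
    by (simp add: add_pos_nonneg)
  then have s_pos: "s r > 0" and s_le: "s r \<le> 1" for r
    by (simp_all add: s_def field_simps)
  have s_norm: "norm (s r *\<^sub>R vs r) = 1 - s r" for r
    using pos[of r] s_pos[of r] by (simp add: s_def divide_simps)
  have "bounded (range (\<lambda>r. (s r *\<^sub>R vs r, s r)))"
  proof (rule bounded_subset[OF compact_imp_bounded])
    show "compact (cball (0::'b) 1 \<times> {0..1::real})"
      by (intro compact_Times) auto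
    show "range (\<lambda>r. (s r *\<^sub>R vs r, s r)) \<subseteq> cball 0 1 \<times> {0..1}"
      using s_pos s_le s_norm by (auto simp: less_imp_le simp del: norm_scaleR)
  qed
  then obtain l k where k: "strict_mono (k :: nat \<Rightarrow> nat)"
    and l: "((\<lambda>r. (s r *\<^sub>R vs r, s r)) \<circ> k) \<longlonglongrightarrow> l"
    using bounded_imp_convergent_subsequence by blast
  define z where "z = fst l"
  define t where "t = snd l"
  have z: "(\<lambda>r. s (k r) *\<^sub>R vs (k r)) \<longlonglongrightarrow> z" and t: "(\<lambda>r. s (k r)) \<longlonglongrightarrow> t"
    using tendsto_fst[OF l] tendsto_snd[OF l] by (simp_all add: z_def t_def o_def)
  note sub = x[THEN LIMSEQ_subseq_LIMSEQ, OF k, unfolded o_def]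
    y[THEN LIMSEQ_subseq_LIMSEQ, OF k, unfolded o_def]
    h[THEN LIMSEQ_subseq_LIMSEQ, OF k, unfolded o_def]
    adj[THEN LIMSEQ_subseq_LIMSEQ, OF k, unfolded o_def]
  \<comment> \<open>If \<open>t = 0\<close>, the \<open>s (k r)\<close> are admissible horizon
    scalars, so \<open>z\<close> is a horizon subgradient in the null space and hence 0; but
    \<open>s_norm\<close> gives \<open>norm z = 1 - t = 1\<close>.\<close>
  have "t \<noteq> 0"
  proof
    assume "t = 0"
    with t have "z \<in> horizon_subdiff h (c x)"
      using horizon_subdiff_limit[where ls = "\<lambda>r. s (k r)", OF fin sub(2,3) v s_pos _ z] by simp
    moreover have "c differentiable at y" for y
      using c unfolding continuously_differentiable_def differentiable_def by blast
    then have "(\<lambda>r. adj_deriv c (xs (k r)) (s (k r) *\<^sub>R vs (k r))) \<longlonglongrightarrow> 0"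
      using tendsto_scaleR[OF t sub(4)] by (simp add: adj_deriv_scaleR)
    then have "adj_deriv c x z = 0"
      using tendsto_adj_deriv[OF c sub(1) z] LIMSEQ_unique by blast
    ultimately have "z = 0" using cq by blast
    moreover have "(\<lambda>r. 1 - s (k r)) \<longlonglongrightarrow> norm z"
      using tendsto_norm[OF z] unfolding s_norm .
    moreover have "(\<lambda>r. 1 - s (k r)) \<longlonglongrightarrow> 1 - t"
      by (intro tendsto_intros t)
    ultimately show False using \<open>t = 0\<close> LIMSEQ_unique by fastforce
  qed
  have "(\<lambda>r. inverse (s (k r)) *\<^sub>R (s (k r) *\<^sub>R vs (k r))) \<longlonglongrightarrow> inverse t *\<^sub>R z"
    by (intro tendsto_intros t z \<open>t \<noteq> 0\<close>)
  moreover have "inverse (s r) *\<^sub>R (s r *\<^sub>R vs r) = vs r" for r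
    using s_pos[of r] by simp
  ultimately have lim: "(\<lambda>r. vs (k r)) \<longlonglongrightarrow> inverse t *\<^sub>R z" by simp
  have "adj_deriv c x (inverse t *\<^sub>R z) = 0"
    using tendsto_adj_deriv[OF c sub(1) lim] sub(4) LIMSEQ_unique by blast
  moreover have "inverse t *\<^sub>R z \<in> subdiff h (c x)"
    by (rule subdiff_limit[OF fin sub(2,3) v lim])
  ultimately show ?thesis
    using that[OF k] lim by (simp add: o_def multiplier_vector_def)
qed

text \<open>Sequential compactness is the preceding lemma with both base point sequences
  constant.\<close>

lemma compact_multiplier_vectors:
  fixes h :: "'b::euclidean_space \<Rightarrow> ereal" and c :: "'a::euclidean_space \<Rightarrow> 'b"
  assumes "continuously_differentiable c"
    and "horizon_subdiff h (c x) \<inter> {v. adj_deriv c x v = 0} = {0}"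
  shows "compact {v. multiplier_vector h c x v}"
  unfolding compact_def
proof (intro allI impI)
  fix vs :: "nat \<Rightarrow> 'b"
  assume "\<forall>r. vs r \<in> {v. multiplier_vector h c x v}"
  then have vs: "vs r \<in> subdiff h (c x)" "adj_deriv c x (vs r) = 0" for r
    by (auto simp: multiplier_vector_def)
  have "(\<lambda>r. adj_deriv c x (vs r)) \<longlonglongrightarrow> 0" by (simp add: vs)
  from multiplier_vector_subsequence[OF assms tendsto_const tendsto_const tendsto_const vs(1) this]
  show "\<exists>l\<in>{v. multiplier_vector h c x v}. \<exists>k. strict_mono k \<and> (vs \<circ> k) \<longlonglongrightarrow> l"
    by (metis mem_Collect_eq)
qed

section \<open>Separation from the bad sets and contradiction\<close>

theorem corollary2p3:
  fixes h :: "real ^ 'm \<Rightarrow> ereal"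
    and c :: "real ^ 'n \<Rightarrow> real ^ 'm"
    and xbar :: "real ^ 'n"
    and \<G> :: "((real ^ 'm) \<times> (real ^ 'm)) set set"
  assumes "lower_semicontinuous h"
    and "continuously_differentiable c"
    and "critical_point (h \<circ> c) xbar"
    and "horizon_subdiff h (c xbar) \<inter> {v. adj_deriv c xbar v = 0} = {0}"
    and "finite \<G>"
    and "\<And>G. G \<in> \<G> \<Longrightarrow> closed G \<and> G \<subseteq> gph_subdiff h"
  shows "\<exists>\<epsilon>bar>0. \<forall>\<epsilon>. 0 < \<epsilon> \<and> \<epsilon> < \<epsilon>bar \<longrightarrow>
           (\<exists>\<delta>>0. \<forall>x. norm (x - xbar) < \<delta> \<longrightarrow>
              (\<forall>G\<in>\<G>. \<forall>chat v.
                 dist_to_set (chat, v) G < ereal \<epsilon> \<and>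
                 v \<in> subdiff h chat \<and>
                 norm (chat - c x) < \<delta> \<and>
                 \<bar>h chat - h (c xbar)\<bar> < ereal \<delta> \<and>
                 norm (adj_deriv c x v) < \<delta>
                 \<longrightarrow> actively_sufficient h c xbar G))"
proof -
  define B where "B = \<Union>{G \<in> \<G>. \<not> actively_sufficient h c xbar G}"
  define M where "M = {v. multiplier_vector h c xbar v}"
  have "closed B"
    unfolding B_def using assms(5,6) by (intro closed_Union) auto
  moreover have "compact ({c xbar} \<times> M)"
    unfolding M_def using compact_multiplier_vectors[OF assms(2,4)] by (intro compact_Times) auto
  \<comment> \<open>A member of the family containing \<open>(c xbar, v)\<close> with
    \<open>v\<close> a multiplier is actively sufficient, so it is not part of
    \<open>B\<close>.\<close>
  moreover have "({c xbar} \<times> M) \<inter> B = {}"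
    using assms(6) by (auto simp: B_def M_def actively_sufficient_def)
  ultimately obtain d where "d > 0" and d: "\<forall>p\<in>{c xbar} \<times> M. \<forall>q\<in>B. d \<le> dist p q"
    using separate_compact_closed by metis
  have "0 \<in> horizon_subdiff h (c xbar)"
    using assms(4) by blast
  then have fin: "\<bar>h (c xbar)\<bar> \<noteq> \<infinity>"
    unfolding horizon_subdiff_def by simp
  have "\<exists>\<delta>>0. \<forall>x. norm (x - xbar) < \<delta> \<longrightarrow>
              (\<forall>G\<in>\<G>. \<forall>chat v.
                 dist_to_set (chat, v) G < ereal \<epsilon> \<and>
                 v \<in> subdiff h chat \<and>
                 norm (chat - c x) < \<delta> \<and>
                 \<bar>h chat - h (c xbar)\<bar> < ereal \<delta> \<and>
                 norm (adj_deriv c x v) < \<delta>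
                 \<longrightarrow> actively_sufficient h c xbar G)" (is "\<exists>\<delta>>0. ?P \<delta>")
    if "\<epsilon> < d" for \<epsilon>
  proof (rule ccontr)
    assume neg: "\<not> (\<exists>\<delta>>0. ?P \<delta>)"
    \<comment> \<open>Counterexamples for \<delta> = \<open>1/(r+1)\<close>. The offending set may
      vary with \<open>r\<close>; keeping only a nearby point \<open>b\<close> of the union
      \<open>B\<close> removes that dependence.\<close>
    have "\<forall>r. \<exists>x y v b. norm (x - xbar) < inverse (real (Suc r)) \<and> v \<in> subdiff h y \<and>
            norm (y - c x) < inverse (real (Suc r)) \<and>
            \<bar>h y - h (c xbar)\<bar> < ereal (inverse (real (Suc r))) \<and>
            norm (adj_deriv c x v) < inverse (real (Suc r)) \<and> b \<in> B \<and> dist (y, v) b < \<epsilon>"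
    proof
      fix r
      have "\<not> ?P (inverse (real (Suc r)))"
      proof
        assume "?P (inverse (real (Suc r)))"
        then have "\<exists>\<delta>>0. ?P \<delta>"
          by (intro exI[of _ "inverse (real (Suc r))"] conjI) simp
        with neg show False by (rule notE)
      qed
      then obtain x G y v where G: "G \<in> \<G>" "\<not> actively_sufficient h c xbar G"
          "dist_to_set (y, v) G < ereal \<epsilon>"
        and *: "norm (x - xbar) < inverse (real (Suc r))" "v \<in> subdiff h y"
          "norm (y - c x) < inverse (real (Suc r))"
          "\<bar>h y - h (c xbar)\<bar> < ereal (inverse (real (Suc r)))"
          "norm (adj_deriv c x v) < inverse (real (Suc r))"
        by blast
      \<comment> \<open>The empty set is at distance \<infinity>, so \<open>G\<close> is nonempty,
        and an infimum strictly below \<epsilon> is undercut by an actual point.\<close>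
      from G(3) have "G \<noteq> {}" "infdist (y, v) G < \<epsilon>"
        by (auto simp: dist_to_set_def split: if_splits)
      then obtain b where "b \<in> G" "dist (y, v) b < \<epsilon>"
        by (metis cINF_less_iff[OF _ bdd_below_image_dist] infdist_notempty)
      with G have "b \<in> B" by (auto simp: B_def)
      with * \<open>dist (y, v) b < \<epsilon>\<close>
      show "\<exists>x y v b. norm (x - xbar) < inverse (real (Suc r)) \<and> v \<in> subdiff h y \<and>
            norm (y - c x) < inverse (real (Suc r)) \<and>
            \<bar>h y - h (c xbar)\<bar> < ereal (inverse (real (Suc r))) \<and>
            norm (adj_deriv c x v) < inverse (real (Suc r)) \<and> b \<in> B \<and> dist (y, v) b < \<epsilon>"
        by blast
    qed
    then obtain xs ys vs bs where
      near: "\<And>r. norm (xs r - xbar) < inverse (real (Suc r))"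
        "\<And>r. norm (ys r - c (xs r)) < inverse (real (Suc r))"
        "\<And>r. norm (adj_deriv c (xs r) (vs r)) < inverse (real (Suc r))"
      and hnear: "\<And>r. \<bar>h (ys r) - h (c xbar)\<bar> < ereal (inverse (real (Suc r)))"
      and vs: "\<And>r. vs r \<in> subdiff h (ys r)"
      and bs: "\<And>r. bs r \<in> B" "\<And>r. dist (ys r, vs r) (bs r) < \<epsilon>"
      by metis
    have xs: "xs \<longlonglongrightarrow> xbar"
      using tendsto_of_dist_inverse_Suc[of xs "\<lambda>_. xbar"] near(1) by (simp add: dist_norm LIM_zero_iff)
    have adj: "(\<lambda>r. adj_deriv c (xs r) (vs r)) \<longlonglongrightarrow> 0"
      using tendsto_of_dist_inverse_Suc[of "\<lambda>r. adj_deriv c (xs r) (vs r)" "\<lambda>_. 0"] near(3) by simp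
    have "isCont c xbar"
      using assms(2) has_derivative_continuous unfolding continuously_differentiable_def by blast
    then have "(\<lambda>r. c (xs r)) \<longlonglongrightarrow> c xbar"
      using xs by (rule isCont_tendsto_compose)
    from tendsto_add[OF tendsto_of_dist_inverse_Suc[of ys "\<lambda>r. c (xs r)"] this]
    have ys: "ys \<longlonglongrightarrow> c xbar"
      using near(2) by (simp add: dist_norm)
    \<comment> \<open>Finiteness at points with subgradients turns the extended-real bound in
      \<open>hnear\<close> into a real one.\<close>
    have real: "ereal (real_of_ereal (h (ys r))) = h (ys r)" for r
      using vs[of r] by (simp add: subdiff_def ereal_real')
    have "\<bar>ereal (real_of_ereal (h (ys r))) - ereal (real_of_ereal (h (c xbar)))\<bar> < ereal (inverse (real (Suc r)))" for r
      using hnear[of r] unfolding real ereal_real'[OF fin] .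
    then have "(\<lambda>r. real_of_ereal (h (ys r))) \<longlonglongrightarrow> real_of_ereal (h (c xbar))"
      using tendsto_of_dist_inverse_Suc[of "\<lambda>r. real_of_ereal (h (ys r))" "\<lambda>_. real_of_ereal (h (c xbar))"]
      by (simp add: dist_real_def LIM_zero_iff)
    then have "(\<lambda>r. ereal (real_of_ereal (h (ys r)))) \<longlonglongrightarrow> ereal (real_of_ereal (h (c xbar)))"
      by (rule tendsto_ereal)
    then have "(\<lambda>r. h (ys r)) \<longlonglongrightarrow> h (c xbar)"
      unfolding real ereal_real'[OF fin] .
    from multiplier_vector_subsequence[OF assms(2,4) xs ys this vs adj]
    obtain k v where k: "strict_mono (k :: nat \<Rightarrow> nat)" and lim: "(vs \<circ> k) \<longlonglongrightarrow> v" and v: "v \<in> M"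
      unfolding M_def by blast
    have "(\<lambda>r. (ys (k r), vs (k r))) \<longlonglongrightarrow> (c xbar, v)"
      using tendsto_Pair[OF LIMSEQ_subseq_LIMSEQ[OF ys k] lim] by (simp add: o_def)
    \<comment> \<open>The slack \<open>d - \<epsilon>\<close> plus the \<epsilon> from
      \<open>bs\<close> puts a point of \<open>B\<close> closer than \<open>d\<close> to
      \<open>{c xbar} \<times> M\<close>.\<close>
    then have "\<forall>\<^sub>F r in sequentially. dist (ys (k r), vs (k r)) (c xbar, v) < d - \<epsilon>"
      using \<open>\<epsilon> < d\<close> by (intro tendstoD) auto
    then obtain r where "dist (ys (k r), vs (k r)) (c xbar, v) < d - \<epsilon>"
      by (auto simp: eventually_sequentially)
    then have "dist (c xbar, v) (bs (k r)) < d"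
      using bs(2)[of "k r"] dist_triangle3[of "(c xbar, v)" "bs (k r)" "(ys (k r), vs (k r))"]
      by linarith
    moreover have "d \<le> dist (c xbar, v) (bs (k r))"
      using d v bs(1) by simp
    ultimately show False by simp
  qed
  note main = this
  show ?thesis
    by (rule exI[of _ d], rule conjI[OF \<open>d > 0\<close>], rule allI, rule impI, elim conjE, rule main)
qed

end
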